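(* Let $\lambda$ be a continuous differential form of degree $h$ on $\mathbb{R}^n$ (with $h\ge 0$) having the following property: there exists a continuous differential form $\Delta$ of degree $h+1$ on $\mathbb{R}^n$ such that $$\int_{\mathbb{R}^n}\Delta\wedge\omega=\int_{\mathbb{R}^n}\lambda\wedge d\omega$$ for every $C_c^\infty$ differential form $\omega$ of degree $n-h-1$ on $\mathbb{R}^n$. Let $\mu$ be a $C^1$ differential form of degree $h+1$ on $\mathbb{R}^n$ and set $E:=\{y\in\mathbb{R}^n\mid \Delta(y)=\mu(y)\}$. Then $d\mu(x)=0$ for every $x\in E^{(n+1)}$.
   Context: $\mathcal{L}^n$ denotes the Lebesgue outer measure on $\mathbb{R}^n$ and $B(x,r)$ the open ball of radius $r$ centered at $x$. For $E\subset\mathbb{R}^n$ and $m\in[n,+\infty)$, a point $x\in\mathbb{R}^n$ is an $m$-density point of $E$ if $\lim_{r\to0^+}\mathcal{L}^n(B(x,r)\setminus E)/r^m=0$; $E^{(m)}$ denotes the set of all $m$-density points of $E$. A differential form of degree $k$ on $\mathbb{R}^n$ is a $k$-covector field $x\mapsto\sum_{1\le\alpha_1<\dots<\alpha_k\le n}f_\alpha(x)\,dx_{\alpha_1}\wedge\cdots\wedge dx_{\alpha_k}$ (a function when $k=0$); it is continuous, $C^1$, or $C^\infty_c$ if all its coefficients $f_\alpha$ are continuous, $C^1$, or $C^\infty$ with compact support, respectively. $d$ is the exterior derivative. The integral over $\mathbb{R}^n$ of a continuous compactly supported form $g\,dx_1\wedge\cdots\wedge dx_n$ of degree $n$ is $\int_{\mathbb{R}^n}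 g\,d\mathcal{L}^n$. The form degrees $h$, $h+1$, $n-h-1$ are understood to lie between $0$ and $n$ (so $0\le h\le n-1$), and forms of degree greater than $n$ are zero. *)

theory Defs
  imports "HOL-Analysis.Analysis"
begin

text \<open>
  The exterior algebra of the dual of \<open>real ^ 'n\<close> is represented by coordinates: the component at
  \<open>\<alpha> :: 'n set\<close> is the coefficient of \<open>dx\<^sub>\<alpha> = dx\<^sub>a\<^sub>1 \<and> \<dots> \<and> dx\<^sub>a\<^sub>k\<close>, where \<open>a\<^sub>1 < \<dots> < a\<^sub>k\<close> is the
  increasing enumeration of \<open>\<alpha>\<close>. Covectors of all degrees live in one type; the degree of a form
  is a predicate.
\<close>

type_synonym 'n covector = "(real, 'n set) vec"
type_synonym 'n form = "(real, 'n) vec \<Rightarrow> 'n covector"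

definition of_degree :: "nat \<Rightarrow> ('n::finite) form \<Rightarrow> bool" where
  "of_degree k f \<longleftrightarrow> (\<forall>x \<alpha>. card \<alpha> \<noteq> k \<longrightarrow> f x $ \<alpha> = 0)"

text \<open>
  For disjoint \<open>\<alpha>\<close>, \<open>\<beta>\<close>, sorting the concatenation of their increasing enumerations takes as many
  transpositions as there are pairs \<open>(a, b)\<close> in \<open>\<alpha> \<times> \<beta>\<close> with \<open>b < a\<close>; see also \<open>wedge_basis\<close>.
\<close>

definition shuffle_sign :: "('n::{finite,linorder}) set \<Rightarrow> 'n set \<Rightarrow> real" where
  "shuffle_sign \<alpha> \<beta> = (- 1) ^ card {(a, b). a \<in> \<alpha> \<and> b \<in> \<beta> \<and> b < a}"

definition wedge :: "('n::{finite,linorder}) covector \<Rightarrow> 'n covector \<Rightarrow> 'n covector" where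
  "wedge u v = (\<chi> \<gamma>. \<Sum>\<alpha>\<in>Pow \<gamma>. shuffle_sign \<alpha> (\<gamma> - \<alpha>) * u $ \<alpha> * v $ (\<gamma> - \<alpha>))"

lemma wedge_basis:
  "wedge (axis \<alpha> 1) (axis \<beta> 1) =
    (if \<alpha> \<inter> \<beta> = {} then shuffle_sign \<alpha> \<beta> *\<^sub>R axis (\<alpha> \<union> \<beta>) 1 else 0)"
proof -
  have "(\<Sum>\<delta>\<in>Pow \<gamma>. shuffle_sign \<delta> (\<gamma> - \<delta>) * axis \<alpha> 1 $ \<delta> * axis \<beta> 1 $ (\<gamma> - \<delta>)) =
    (if \<alpha> \<inter> \<beta> = {} \<and> \<gamma> = \<alpha> \<union> \<beta> then shuffle_sign \<alpha> \<beta> else 0)" for \<gamma>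
  proof -
    have "(\<Sum>\<delta>\<in>Pow \<gamma>. shuffle_sign \<delta> (\<gamma> - \<delta>) * axis \<alpha> 1 $ \<delta> * axis \<beta> 1 $ (\<gamma> - \<delta>)) =
      (\<Sum>\<delta>\<in>Pow \<gamma>. if \<delta> = \<alpha> then (if \<gamma> - \<alpha> = \<beta> then shuffle_sign \<alpha> \<beta> else 0) else 0)"
      by (rule sum.cong) (auto simp: axis_def)
    also have "\<dots> = (if \<alpha> \<subseteq> \<gamma> \<and> \<gamma> - \<alpha> = \<beta> then shuffle_sign \<alpha> \<beta> else 0)"
      by (simp add: sum.delta)
    also have "\<alpha> \<subseteq> \<gamma> \<and> \<gamma> - \<alpha> = \<beta> \<longleftrightarrow> \<alpha> \<inter> \<beta> = {} \<and> \<gamma> = \<alpha> \<union> \<beta>"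
      by blast
    finally show ?thesis .
  qed
  then show ?thesis
    by (auto simp: wedge_def vec_eq_iff axis_def)
qed

definition partial_deriv :: "'n \<Rightarrow> (real ^ 'n \<Rightarrow> real) \<Rightarrow> real ^ 'n \<Rightarrow> real" where
  "partial_deriv i f x = deriv (\<lambda>t. f (x + t *\<^sub>R axis i 1)) 0"

primrec Ck :: "nat \<Rightarrow> (real ^ 'n \<Rightarrow> real) \<Rightarrow> bool" where
  "Ck 0 f \<longleftrightarrow> continuous_on UNIV f"
| "Ck (Suc k) f \<longleftrightarrow> f differentiable_on UNIV \<and> (\<forall>i. Ck k (partial_deriv i f))"

definition Cc_infinity :: "(real ^ 'n \<Rightarrow> real) \<Rightarrow> bool" where
  "Cc_infinity f \<longleftrightarrow> (\<forall>k. Ck k f) \<and> compact (closure {x. f x \<noteq> 0})"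

definition continuous_form :: "nat \<Rightarrow> ('n::finite) form \<Rightarrow> bool" where
  "continuous_form k f \<longleftrightarrow> of_degree k f \<and> (\<forall>\<alpha>. continuous_on UNIV (\<lambda>x. f x $ \<alpha>))"

definition C1_form :: "nat \<Rightarrow> ('n::finite) form \<Rightarrow> bool" where
  "C1_form k f \<longleftrightarrow> of_degree k f \<and> (\<forall>\<alpha>. Ck 1 (\<lambda>x. f x $ \<alpha>))"

definition Cc_infinity_form :: "nat \<Rightarrow> ('n::finite) form \<Rightarrow> bool" where
  "Cc_infinity_form k f \<longleftrightarrow> of_degree k f \<and> (\<forall>\<alpha>. Cc_infinity (\<lambda>x. f x $ \<alpha>))"

text \<open>\<open>d f = \<Sum>\<^sub>\<alpha> df\<^sub>\<alpha> \<and> dx\<^sub>\<alpha> = \<Sum>\<^sub>i dx\<^sub>i \<and> (\<Sum>\<^sub>\<alpha> (\<partial>\<^sub>i f\<^sub>\<alpha>) dx\<^sub>\<alpha>)\<close>; note \<open>axis {i} 1\<close> is \<open>dx\<^sub>i\<close>.\<close>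

definition ext_deriv :: "('n::{finite,linorder}) form \<Rightarrow> 'n form" where
  "ext_deriv f x = (\<Sum>i\<in>UNIV. wedge (axis {i} 1) (\<chi> \<alpha>. partial_deriv i (\<lambda>y. f y $ \<alpha>) x))"

text \<open>The coefficient at \<open>UNIV\<close> is that of the volume form \<open>dx\<^sub>1 \<and> \<dots> \<and> dx\<^sub>n\<close>.\<close>

definition form_integral :: "('n::finite) form \<Rightarrow> real" where
  "form_integral f = (LINT x|lborel. f x $ UNIV)"

text \<open>
  \<open>outer_measure_of lebesgue\<close> is Lebesgue outer measure on arbitrary sets, so \<open>E\<close> need not be
  measurable. The notion is used for \<open>m \<ge> CARD('n)\<close>.
\<close>

definition density_points :: "real \<Rightarrow> (real ^ 'n) set \<Rightarrow> (real ^ 'n) set" where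
  "density_points m E =
    {x. ((\<lambda>r. outer_measure_of lebesgue (ball x r - E) / ennreal (r powr m)) \<longlongrightarrow> 0) (at_right 0)}"

end

theory Submission
  imports Defs
begin

text \<open>
  The hypothesis says that \<open>\<Delta>\<close> is, up to sign, the weak exterior derivative of \<open>\<lambda>\<close>. Testing it with
  exact forms \<open>\<omega> = d\<eta>\<close> and using \<open>d d = 0\<close> makes \<open>\<lambda>\<close> disappear: the integral of
  \<open>\<Delta> \<and> d\<eta>\<close> vanishes for every test form \<open>\<eta>\<close>, so \<open>\<Delta>\<close> is weakly closed. Take
  \<open>\<eta> = \<phi> dx\<^sub>\<beta>\<close> with a scalar test function \<open>\<phi>\<close> and let \<open>\<gamma>\<close> be the complement of \<open>\<beta>\<close>. Then
  \<open>\<Delta> \<and> d\<eta>\<close> is, up to a global sign, \<open>\<Sum>\<^sub>i v\<^sub>i \<partial>\<^sub>i\<phi>\<close>, where \<open>v\<^sub>i\<close> is the signed coefficient of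
  \<open>\<Delta>\<close> at \<open>\<gamma> - {i}\<close> (\<open>wedge_ext_deriv_complementary_basis\<close>). With \<open>u\<close> built from \<open>\<mu>\<close> in the same
  way, the coefficient of \<open>d\<mu>\<close> at \<open>\<gamma>\<close> is the divergence of \<open>u\<close>. The theorem thus becomes a statement
  about vector fields (\<open>divergence_eq_0_at_density_point\<close>): if \<open>v\<close> is continuous and weakly
  divergence-free and \<open>u\<close> is \<open>C\<^sup>1\<close>, then \<open>div u\<close> vanishes at the \<open>(n+1)\<close>-density points of
  \<open>{u = v}\<close>.

  For this, test with a bump \<open>\<phi>\<^sub>r\<close> of radius \<open>r\<close> around the density point \<open>x\<close>. Integration by parts
  gives \<open>\<integral> (div u) \<phi>\<^sub>r = \<integral> \<Sum>\<^sub>i (v\<^sub>i - u\<^sub>i) \<partial>\<^sub>i\<phi>\<^sub>r\<close>. If \<open>div u\<close> did not vanish at \<open>x\<close>, the left-hand side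
  would be at least a constant times \<open>r\<^sup>n\<close> in absolute value. On the right the integrand lives on the
  part of the ball where \<open>u\<close> and \<open>v\<close> differ, a set of measure \<open>o(r\<^sup>n\<^sup>+\<^sup>1)\<close>, and is \<open>O(1/r)\<close> there; so
  the right-hand side is \<open>o(r\<^sup>n)\<close>. The exponent \<open>n + 1\<close> is exactly what pays for the gradient of the
  bump.
\<close>


section \<open>Partial derivatives and the classes \<open>C\<^sup>k\<close>\<close>

lemma has_real_derivative_line:
  fixes f :: "real ^ 'n \<Rightarrow> real"
  assumes "(f has_derivative D) (at (x + t *\<^sub>R v))"
  shows "((\<lambda>t. f (x + t *\<^sub>R v)) has_real_derivative D v) (at t)"
proof -
  interpret D: bounded_linear D
    using assms by (rule has_derivative_bounded_linear)
  have "((\<lambda>t. f (x + t *\<^sub>R v)) has_derivative (\<lambda>s. D (s *\<^sub>R v))) (at t)"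
    by (rule has_derivative_compose[of "\<lambda>t. x + t *\<^sub>R v" "\<lambda>s. s *\<^sub>R v" t UNIV f D])
      (use assms in \<open>auto intro!: derivative_eq_intros\<close>)
  moreover have "(\<lambda>s. D (s *\<^sub>R v)) = (*) (D v)"
    by (auto simp: D.scaleR)
  ultimately show ?thesis
    by (simp add: has_field_derivative_def)
qed

lemma partial_deriv_eq:
  assumes "(f has_derivative D) (at x)"
  shows "partial_deriv i f x = D (axis i 1)"
  using has_real_derivative_line[of f D x 0 "axis i 1"] assms
  by (simp add: partial_deriv_def DERIV_imp_deriv)

lemma has_real_derivative_partial:
  assumes "f differentiable_on UNIV"
  shows "((\<lambda>t. f (x + t *\<^sub>R axis i 1)) has_real_derivative
    partial_deriv i f (x + t *\<^sub>R axis i 1)) (at t)"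
proof -
  obtain D where D: "(f has_derivative D) (at (x + t *\<^sub>R axis i 1))"
    using assms by (auto simp: differentiable_on_def differentiable_def)
  show ?thesis
    using has_real_derivative_line[OF D] partial_deriv_eq[OF D] by simp
qed

lemma differentiable_on_UNIV_D:
  "f differentiable_on UNIV \<Longrightarrow> (f has_derivative frechet_derivative f (at x)) (at x)"
  by (simp add: differentiable_on_def frechet_derivative_works)

lemma partial_deriv_const: "partial_deriv i (\<lambda>x. c) = (\<lambda>x. 0)"
  by (rule ext) (simp add: partial_deriv_def)

lemma partial_deriv_component: "partial_deriv i (\<lambda>x. x $ j) = (\<lambda>x. if i = j then 1 else 0)"
proof
  fix x :: "real ^ 'a"
  have "((\<lambda>x. x $ j) has_derivative (\<lambda>x. x $ j)) (at x)"
    by (rule bounded_linear_imp_has_derivative[OF bounded_linear_vec_nth])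
  from partial_deriv_eq[OF this] show "partial_deriv i (\<lambda>x. x $ j) x = (if i = j then 1 else 0)"
    by (simp add: axis_def)
qed

lemma partial_deriv_add:
  assumes "f differentiable_on UNIV" "g differentiable_on UNIV"
  shows "partial_deriv i (\<lambda>x. f x + g x) = (\<lambda>x. partial_deriv i f x + partial_deriv i g x)"
proof
  fix x
  note d = assms[THEN differentiable_on_UNIV_D, of x]
  show "partial_deriv i (\<lambda>x. f x + g x) x = partial_deriv i f x + partial_deriv i g x"
    using partial_deriv_eq[OF has_derivative_add[OF d]]
      partial_deriv_eq[OF d(1)] partial_deriv_eq[OF d(2)] by simp
qed

lemma partial_deriv_mult:
  assumes "f differentiable_on UNIV" "g differentiable_on UNIV"
  shows "partial_deriv i (\<lambda>x. f x * g x) =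
    (\<lambda>x. f x * partial_deriv i g x + partial_deriv i f x * g x)"
proof
  fix x
  note d = assms[THEN differentiable_on_UNIV_D, of x]
  show "partial_deriv i (\<lambda>x. f x * g x) x = f x * partial_deriv i g x + partial_deriv i f x * g x"
    using partial_deriv_eq[OF has_derivative_mult[OF d]]
      partial_deriv_eq[OF d(1)] partial_deriv_eq[OF d(2)] by simp
qed

lemma partial_deriv_cmult:
  assumes "f differentiable_on UNIV"
  shows "partial_deriv i (\<lambda>x. c * f x) = (\<lambda>x. c * partial_deriv i f x)"
  using partial_deriv_mult[of "\<lambda>_. c" f i] assms by (simp add: partial_deriv_const)

lemma partial_deriv_sum:
  assumes "finite A" "\<And>a. a \<in> A \<Longrightarrow> f a differentiable_on UNIV"
  shows "partial_deriv i (\<lambda>x. \<Sum>a\<in>A. f a x) = (\<lambda>x. \<Sum>a\<in>A. partial_deriv i (f a) x)"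
  using assms
proof (induction A rule: finite_induct)
  case (insert a A)
  then show ?case
    by (simp add: partial_deriv_add differentiable_on_def)
qed (simp add: partial_deriv_const)

lemma partial_deriv_chain:
  assumes f: "\<And>t. (f has_real_derivative f' t) (at t)" and q: "q differentiable_on UNIV"
  shows "partial_deriv i (\<lambda>x. f (q x)) = (\<lambda>x. f' (q x) * partial_deriv i q x)"
proof
  fix x
  note d = q[THEN differentiable_on_UNIV_D, of x]
  have "((\<lambda>x. f (q x)) has_derivative (\<lambda>y. f' (q x) * frechet_derivative q (at x) y)) (at x)"
    using has_derivative_compose[OF d, of f] f[of "q x"] by (simp add: has_field_derivative_def)
  from partial_deriv_eq[OF this] partial_deriv_eq[OF d]
  show "partial_deriv i (\<lambda>x. f (q x)) x = f' (q x) * partial_deriv i q x"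
    by simp
qed

lemma Ck_Suc_imp_Ck: "Ck (Suc k) f \<Longrightarrow> Ck k f"
proof (induction k arbitrary: f)
  case 0
  then show ?case by (simp add: differentiable_imp_continuous_on)
next
  case (Suc k)
  then show ?case by simp
qed

lemma Ck_imp_continuous: "Ck k f \<Longrightarrow> continuous_on UNIV f"
  by (cases k) (auto simp: differentiable_imp_continuous_on)

lemma Ck_const: "Ck k (\<lambda>x. c)"
  by (induction k arbitrary: c) (auto simp: partial_deriv_const)

lemma Ck_component: "Ck k (\<lambda>x. x $ j)"
proof (cases k)
  case (Suc l)
  have "(\<lambda>x :: real ^ 'a. x $ j) differentiable_on UNIV"
    by (rule bounded_linear_imp_differentiable_on[OF bounded_linear_vec_nth])
  then show ?thesis
    by (simp add: Suc partial_deriv_component Ck_const)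
qed (auto intro: continuous_intros)

lemma Ck_add: "Ck k f \<Longrightarrow> Ck k g \<Longrightarrow> Ck k (\<lambda>x. f x + g x)"
  by (induction k arbitrary: f g)
    (auto simp: partial_deriv_add differentiable_on_add intro: continuous_intros)

lemma Ck_mult: "Ck k f \<Longrightarrow> Ck k g \<Longrightarrow> Ck k (\<lambda>x. f x * g x)"
proof (induction k arbitrary: f g)
  case (Suc k)
  then show ?case
    using Suc.prems[THEN Ck_Suc_imp_Ck]
    by (auto simp: partial_deriv_mult differentiable_on_mult intro!: Ck_add Suc.IH)
qed (auto intro: continuous_intros)

lemma Ck_sum:
  "finite A \<Longrightarrow> (\<And>a. a \<in> A \<Longrightarrow> Ck k (f a)) \<Longrightarrow> Ck k (\<lambda>x. \<Sum>a\<in>A. f a x)"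
  by (induction A rule: finite_induct) (auto intro: Ck_const Ck_add)

text \<open>
  The second difference \<open>f (x + h e\<^sub>i + h e\<^sub>j) - f (x + h e\<^sub>i) - f (x + h e\<^sub>j) + f x\<close> is symmetric in
  \<open>i\<close> and \<open>j\<close>; two applications of the mean value theorem identify it with \<open>h\<^sup>2\<close> times either mixed
  derivative at points that tend to \<open>x\<close>.
\<close>

lemma second_difference_mean_value:
  fixes f :: "real ^ 'n \<Rightarrow> real" and h :: real
  assumes f: "Ck 2 f" and h: "0 < h"
  shows "\<exists>z \<in> cball x (2 * h).
    f (x + h *\<^sub>R axis i 1 + h *\<^sub>R axis j 1) - f (x + h *\<^sub>R axis i 1) - f (x + h *\<^sub>R axis j 1) + f x =
    h\<^sup>2 * partial_deriv j (partial_deriv i f) z"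
proof -
  have df: "f differentiable_on UNIV" and dif: "partial_deriv i f differentiable_on UNIV"
    using f by (simp_all add: numeral_2_eq_2)
  define \<phi> where "\<phi> s = f ((x + h *\<^sub>R axis j 1) + s *\<^sub>R axis i 1) - f (x + s *\<^sub>R axis i 1)" for s
  have "\<exists>\<xi>. 0 < \<xi> \<and> \<xi> < h \<and> \<phi> h - \<phi> 0 = (h - 0) *
    (partial_deriv i f ((x + h *\<^sub>R axis j 1) + \<xi> *\<^sub>R axis i 1) - partial_deriv i f (x + \<xi> *\<^sub>R axis i 1))"
    unfolding \<phi>_def
    by (rule MVT2[OF h]) (intro DERIV_diff has_real_derivative_partial[OF df])
  then obtain \<xi> where \<xi>: "0 < \<xi>" "\<xi> < h" and 1: "\<phi> h - \<phi> 0 = h *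
    (partial_deriv i f ((x + h *\<^sub>R axis j 1) + \<xi> *\<^sub>R axis i 1) - partial_deriv i f (x + \<xi> *\<^sub>R axis i 1))"
    by auto
  define \<psi> where "\<psi> t = partial_deriv i f ((x + \<xi> *\<^sub>R axis i 1) + t *\<^sub>R axis j 1)" for t
  have "\<exists>\<eta>. 0 < \<eta> \<and> \<eta> < h \<and> \<psi> h - \<psi> 0 = (h - 0) *
    partial_deriv j (partial_deriv i f) ((x + \<xi> *\<^sub>R axis i 1) + \<eta> *\<^sub>R axis j 1)"
    unfolding \<psi>_def by (rule MVT2[OF h]) (rule has_real_derivative_partial[OF dif])
  then obtain \<eta> where \<eta>: "0 < \<eta>" "\<eta> < h" and 2: "\<psi> h - \<psi> 0 = h *
    partial_deriv j (partial_deriv i f) ((x + \<xi> *\<^sub>R axis i 1) + \<eta> *\<^sub>R axis j 1)"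
    by auto
  let ?z = "(x + \<xi> *\<^sub>R axis i 1) + \<eta> *\<^sub>R axis j 1"
  have "dist ?z x \<le> norm (\<xi> *\<^sub>R axis i (1::real) :: real ^ 'n) + norm (\<eta> *\<^sub>R axis j (1::real) :: real ^ 'n)"
    using norm_triangle_ineq[of "\<xi> *\<^sub>R axis i (1::real) :: real ^ 'n" "\<eta> *\<^sub>R axis j 1"]
    by (simp add: dist_norm add.assoc)
  also have "\<dots> \<le> 2 * h"
    using \<xi> \<eta> by simp
  finally have "?z \<in> cball x (2 * h)" by (simp add: dist_commute)
  moreover have "f (x + h *\<^sub>R axis i 1 + h *\<^sub>R axis j 1) - f (x + h *\<^sub>R axis i 1)
    - f (x + h *\<^sub>R axis j 1) + f x = \<phi> h - \<phi> 0"
    by (simp add: \<phi>_def algebra_simps)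
  moreover have "\<phi> h - \<phi> 0 = h * (\<psi> h - \<psi> 0)"
    unfolding 1 by (simp add: \<psi>_def add_ac)
  ultimately show ?thesis
    using 2 by (metis mult.assoc power2_eq_square)
qed

lemma mixed_partial_deriv_commute:
  fixes f :: "real ^ 'n \<Rightarrow> real"
  assumes f: "Ck 2 f"
  shows "partial_deriv i (partial_deriv j f) x = partial_deriv j (partial_deriv i f) x"
proof -
  define a where "a = partial_deriv i (partial_deriv j f)"
  define b where "b = partial_deriv j (partial_deriv i f)"
  have cont: "isCont a x" "isCont b x"
    using f by (auto simp: a_def b_def numeral_2_eq_2 continuous_on_eq_continuous_at)
  have "\<exists>z w. dist x z \<le> 2 * h \<and> dist x w \<le> 2 * h \<and> a z = b w" if h: "0 < h" for h :: real
  proof -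
    obtain w where w: "w \<in> cball x (2 * h)" "f (x + h *\<^sub>R axis i 1 + h *\<^sub>R axis j 1)
        - f (x + h *\<^sub>R axis i 1) - f (x + h *\<^sub>R axis j 1) + f x = h\<^sup>2 * b w"
      unfolding b_def using second_difference_mean_value[OF f h] by blast
    obtain z where z: "z \<in> cball x (2 * h)" "f (x + h *\<^sub>R axis j 1 + h *\<^sub>R axis i 1)
        - f (x + h *\<^sub>R axis j 1) - f (x + h *\<^sub>R axis i 1) + f x = h\<^sup>2 * a z"
      unfolding a_def using second_difference_mean_value[OF f h] by blast
    have e: "x + h *\<^sub>R axis j 1 + h *\<^sub>R axis i 1 = x + h *\<^sub>R axis i 1 + h *\<^sub>R axis j 1"
      by (simp add: add_ac)
    have "h\<^sup>2 * a z = h\<^sup>2 * b w"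
      using z(2)[unfolded e] w(2) by linarith
    then show ?thesis
      using h z(1) w(1) by auto
  qed
  then have "\<forall>n. \<exists>p. dist x (fst p) \<le> 2 * inverse (real (Suc n)) \<and>
      dist x (snd p) \<le> 2 * inverse (real (Suc n)) \<and> a (fst p) = b (snd p)"
    by (simp del: of_nat_Suc)
  from choice[OF this] obtain p where p: "\<And>n. dist x (fst (p n)) \<le> 2 * inverse (real (Suc n))"
    "\<And>n. dist x (snd (p n)) \<le> 2 * inverse (real (Suc n))" "\<And>n. a (fst (p n)) = b (snd (p n))"
    by blast
  have lim0: "(\<lambda>n. 2 * inverse (real (Suc n))) \<longlonglongrightarrow> 0"
    using tendsto_mult[OF tendsto_const[of 2] LIMSEQ_inverse_real_of_nat] by simp
  have lim: "u \<longlonglongrightarrow> x" if "\<And>n. dist x (u n) \<le> 2 * inverse (real (Suc n))" for u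
  proof -
    have "(\<lambda>n. dist (u n) x) \<longlonglongrightarrow> 0"
      by (rule tendsto_sandwich[OF _ _ tendsto_const lim0]) (use that in \<open>auto simp: dist_commute\<close>)
    then show ?thesis
      by (rule tendsto_dist_iff[THEN iffD2])
  qed
  have "(\<lambda>n. a (fst (p n))) \<longlonglongrightarrow> a x" "(\<lambda>n. b (snd (p n))) \<longlonglongrightarrow> b x"
    by (rule isCont_tendsto_compose[OF cont(1) lim[OF p(1)]],
        rule isCont_tendsto_compose[OF cont(2) lim[OF p(2)]])
  then have "a x = b x"
    unfolding p(3) by (rule LIMSEQ_unique)
  then show ?thesis
    by (simp add: a_def b_def)
qed

section \<open>A smooth bump function\<close>

text \<open>
  For \<open>k = 0\<close> this is the standard smooth function that vanishes on the negative half-line. The factor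
  \<open>t\<^sup>-\<^sup>k\<close> is there because the linear span of the family is then closed under differentiation, so that
  smoothness of all members follows by one induction (\<open>Ck_flat_compose\<close>).
\<close>

definition flat :: "nat \<Rightarrow> real \<Rightarrow> real" where
  "flat k t = (if t \<le> 0 then 0 else inverse t ^ k / exp (inverse t))"

lemma flat_tendsto_0: "(flat k \<longlongrightarrow> 0) (at 0)"
proof (rule filterlim_split_at)
  have "eventually (\<lambda>t. 0 = flat k t) (at_left 0)"
    by (auto simp: flat_def eventually_at_filter)
  then show "(flat k \<longlongrightarrow> 0) (at_left 0)"
    by (rule Lim_transform_eventually[OF tendsto_const])
  have "((\<lambda>t. inverse t ^ k / exp (inverse t)) \<longlongrightarrow> (0::real)) (at_right 0)"
    by (rule filterlim_compose[OF tendsto_power_div_exp_0 filterlim_inverse_at_top_right])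
  moreover have "eventually (\<lambda>t. inverse t ^ k / exp (inverse t) = flat k t) (at_right 0)"
    by (auto simp: flat_def eventually_at_filter)
  ultimately show "(flat k \<longlongrightarrow> 0) (at_right 0)"
    by (rule Lim_transform_eventually)
qed

lemma flat_has_derivative:
  "(flat k has_real_derivative flat (k + 2) t - k * flat (k + 1) t) (at t)"
proof -
  consider "t < 0" | "t = 0" | "t > 0" by linarith
  then show ?thesis
  proof cases
    case 1
    have "((\<lambda>_. 0) has_real_derivative 0) (at t)" by simp
    moreover have "eventually (\<lambda>s. s \<in> {..<0}) (nhds t)"
      using 1 by (intro eventually_nhds_in_open) auto
    then have "eventually (\<lambda>s. 0 = flat k s) (nhds t)"
      by eventually_elim (simp add: flat_def)
    ultimately show ?thesis
      using 1 by (subst (asm) DERIV_cong_ev[OF refl]) (auto simp: flat_def)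
  next
    case 2
    have "eventually (\<lambda>h. flat (k + 1) h = (flat k (0 + h) - flat k 0) / h) (at 0)"
      by (auto simp: flat_def eventually_at_filter divide_inverse)
    then have "(\<lambda>h. (flat k (0 + h) - flat k 0) / h) \<midarrow>0\<rightarrow> 0"
      by (rule Lim_transform_eventually[OF flat_tendsto_0])
    then show ?thesis
      using 2 by (simp add: DERIV_def flat_def)
  next
    case 3
    have aux: "m \<noteq> 0 \<Longrightarrow> t * t ^ (m - Suc 0) = t ^ m" for m
      by (cases m) auto
    have "((\<lambda>t. inverse t ^ k / exp (inverse t)) has_real_derivative
      flat (k + 2) t - k * flat (k + 1) t) (at t)"
      using 3 by (cases k)
        (auto intro!: derivative_eq_intros simp: flat_def field_simps power2_eq_square,
          use aux in blast)
    moreover have "eventually (\<lambda>s. s \<in> {0<..}) (nhds t)"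
      using 3 by (intro eventually_nhds_in_open) auto
    then have "eventually (\<lambda>s. inverse s ^ k / exp (inverse s) = flat k s) (nhds t)"
      by eventually_elim (simp add: flat_def)
    ultimately show ?thesis
      by (subst (asm) DERIV_cong_ev[OF refl]) auto
  qed
qed

lemma Ck_flat_compose:
  assumes q: "\<And>m. Ck m q"
  shows "Ck m (\<lambda>x. flat k (q x))"
proof (induction m arbitrary: k)
  case 0
  have "isCont (flat k) t" for t
    using DERIV_isCont[OF flat_has_derivative] .
  then have "continuous_on UNIV (flat k)"
    by (simp add: continuous_at_imp_continuous_on)
  then show ?case
    using continuous_on_compose2[of UNIV "flat k" UNIV q] q[of 0] by simp
next
  case (Suc m)
  have dq: "q differentiable_on UNIV"
    using q[of 1] by simp
  have "(\<lambda>x. flat k (q x)) differentiable at x" for x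
  proof -
    have "flat k differentiable at (q x)"
      using flat_has_derivative unfolding real_differentiable_def by blast
    moreover have "q differentiable at x"
      using dq by (simp add: differentiable_on_def)
    ultimately show ?thesis
      by (rule differentiable_compose[of "flat k" q])
  qed
  then have "(\<lambda>x. flat k (q x)) differentiable_on UNIV"
    by (simp add: differentiable_on_def)
  moreover have "Ck m (partial_deriv i (\<lambda>x. flat k (q x)))" for i
  proof -
    have "Ck m (\<lambda>x. (flat (k + 2) (q x) + (- real k) * flat (k + 1) (q x)) * partial_deriv i q x)"
      using q[of "Suc m"] by (intro Ck_mult Ck_add Ck_const Suc.IH) simp
    then show ?thesis
      by (simp add: partial_deriv_chain[OF flat_has_derivative dq])
  qed
  ultimately show ?case by simp
qed

text \<open>
  The argument of \<open>flat 0\<close> is a polynomial in \<open>y\<close> which is positive exactly on the ball of radius \<open>r\<close>;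
  the quotient by \<open>r\<^sup>2\<close> makes the height independent of \<open>r\<close> and the gradient of order \<open>1 / r\<close>.
\<close>

definition bump :: "real ^ 'n \<Rightarrow> real \<Rightarrow> real ^ 'n \<Rightarrow> real" where
  "bump x r y = flat 0 (1 - (norm (y - x))\<^sup>2 / r\<^sup>2)"

context
  fixes x :: "real ^ 'n" and r :: real
  assumes r: "0 < r"
begin

lemma bump_nonneg: "0 \<le> bump x r y"
  by (simp add: bump_def flat_def)

lemma bump_eq_0:
  assumes "y \<notin> ball x r"
  shows "bump x r y = 0"
proof -
  have "r\<^sup>2 \<le> (norm (y - x))\<^sup>2"
    using assms r by (intro power_mono) (auto simp: dist_norm norm_minus_commute)
  then show ?thesis
    using r by (simp add: bump_def flat_def)
qed

lemma bump_ge: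
  assumes "y \<in> ball x (r / 2)"
  shows "exp (- 2) \<le> bump x r y"
proof -
  have "(norm (y - x))\<^sup>2 \<le> (r / 2)\<^sup>2"
    using assms by (intro power_mono) (auto simp: dist_norm norm_minus_commute)
  then have "4 * (norm (y - x))\<^sup>2 \<le> r\<^sup>2"
    by (simp add: field_simps)
  then have "2 * (norm (y - x))\<^sup>2 \<le> r\<^sup>2"
    using zero_le_power2[of "norm (y - x)"] by linarith
  then have t: "1 / 2 \<le> 1 - (norm (y - x))\<^sup>2 / r\<^sup>2" (is "_ \<le> ?t")
    using r by (simp add: field_simps)
  then have "inverse ?t \<le> inverse (1 / 2)"
    by (intro le_imp_inverse_le) auto
  then have "exp (- 2) \<le> exp (- inverse ?t)"
    by simp
  moreover have f: "flat 0 s = exp (- inverse s)" if "0 < s" for s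
    using that by (simp add: flat_def exp_minus inverse_eq_divide)
  have "flat 0 ?t = exp (- inverse ?t)"
    using t by (intro f) linarith
  ultimately show ?thesis
    unfolding bump_def by (simp only:)
qed

lemma Ck_bump_argument: "Ck m (\<lambda>y. 1 - (norm (y - x))\<^sup>2 / r\<^sup>2)"
proof -
  have "Ck m (\<lambda>y. 1 + (- inverse (r\<^sup>2)) * (\<Sum>j\<in>UNIV. (y $ j + (- x $ j)) * (y $ j + (- x $ j))))"
    by (intro Ck_add Ck_mult Ck_sum Ck_const Ck_component) simp
  moreover have "(\<lambda>y. 1 + (- inverse (r\<^sup>2)) * (\<Sum>j\<in>UNIV. (y $ j + (- x $ j)) * (y $ j + (- x $ j)))) =
    (\<lambda>y. 1 - (norm (y - x))\<^sup>2 / r\<^sup>2)"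
    by (auto simp: power2_norm_eq_inner inner_vec_def divide_inverse)
  ultimately show ?thesis by metis
qed

lemma Cc_infinity_bump: "Cc_infinity (bump x r)"
  unfolding Cc_infinity_def
proof
  show "\<forall>m. Ck m (bump x r)"
    unfolding bump_def[abs_def] by (intro allI Ck_flat_compose Ck_bump_argument)
  have "{y. bump x r y \<noteq> 0} \<subseteq> ball x r"
    using bump_eq_0 by blast
  then show "compact (closure {y. bump x r y \<noteq> 0})"
    using bounded_subset[OF bounded_ball] compact_closure by blast
qed

lemma partial_deriv_bump:
  "partial_deriv i (bump x r) y =
    - (2 * (y $ i - x $ i) / r\<^sup>2) * flat 2 (1 - (norm (y - x))\<^sup>2 / r\<^sup>2)"
proof -
  let ?q = "\<lambda>y. 1 - (norm (y - x))\<^sup>2 / r\<^sup>2"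
  have "((\<lambda>y. 1 - inverse (r\<^sup>2) * ((y - x) \<bullet> (y - x))) has_derivative
      (\<lambda>v. - (inverse (r\<^sup>2) * (2 * ((y - x) \<bullet> v))))) (at y)"
  proof -
    have d: "((\<lambda>y. y - x) has_derivative (\<lambda>v. v)) (at y)"
      by (rule derivative_eq_intros refl | simp)+
    show ?thesis
      using has_derivative_diff[OF has_derivative_const[of 1]
          has_derivative_mult_right[OF has_derivative_inner[OF d d], of "inverse (r\<^sup>2)"]]
      by (simp add: inner_commute)
  qed
  from partial_deriv_eq[OF this, of i]
  have "partial_deriv i ?q y = - (2 * (y $ i - x $ i) / r\<^sup>2)"
    by (simp add: power2_norm_eq_inner inner_axis divide_inverse mult_ac)
  moreover have "?q differentiable_on UNIV"
    using Ck_bump_argument[of 1] by simp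
  ultimately show ?thesis
    unfolding bump_def[abs_def] by (simp add: partial_deriv_chain[OF flat_has_derivative] numeral_2_eq_2)
qed

lemma partial_deriv_bump_eq_0:
  assumes "y \<notin> ball x r"
  shows "partial_deriv i (bump x r) y = 0"
proof -
  have "r\<^sup>2 \<le> (norm (y - x))\<^sup>2"
    using assms r by (intro power_mono) (auto simp: dist_norm norm_minus_commute)
  then show ?thesis
    using r by (simp add: partial_deriv_bump flat_def)
qed

lemma abs_partial_deriv_bump_le: "\<bar>partial_deriv i (bump x r) y\<bar> \<le> 4 / r"
proof (cases "y \<in> ball x r")
  case True
  \<comment> \<open>\<open>s\<^sup>2 exp (- s) \<le> 2\<close> for \<open>s \<ge> 0\<close>, from the quadratic Taylor term of \<open>exp s\<close>\<close>
  have flat2: "0 \<le> flat 2 t \<and> flat 2 t \<le> 2" for t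
  proof (cases "t \<le> 0")
    case False
    then have "0 < inverse t" by simp
    then have "(inverse t)\<^sup>2 \<le> 2 * exp (inverse t)"
      using exp_lower_Taylor_quadratic[of "inverse t"] by linarith
    then show ?thesis
      using False by (simp add: flat_def pos_divide_le_eq)
  qed (simp add: flat_def)
  have "\<bar>y $ i - x $ i\<bar> \<le> r"
    using component_le_norm_cart[of "y - x" i] True by (simp add: dist_norm norm_minus_commute)
  then have "\<bar>2 * (y $ i - x $ i) / r\<^sup>2\<bar> \<le> 2 * r / r\<^sup>2"
    using r by (auto simp: abs_mult intro!: divide_right_mono)
  then have "\<bar>2 * (y $ i - x $ i) / r\<^sup>2\<bar> * \<bar>flat 2 (1 - (norm (y - x))\<^sup>2 / r\<^sup>2)\<bar> \<le> (2 * r / r\<^sup>2) * 2"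
    using flat2 r by (intro mult_mono) auto
  also have "\<dots> = 4 / r"
    using r by (simp add: power2_eq_square)
  finally show ?thesis
    by (simp add: partial_deriv_bump abs_mult)
next
  case False
  then show ?thesis
    using r by (simp add: partial_deriv_bump_eq_0)
qed

end

section \<open>Integration by parts\<close>

lemma integrable_continuous_bounded_support:
  fixes f :: "'a::euclidean_space \<Rightarrow> real"
  assumes "continuous_on UNIV f" "bounded {x. f x \<noteq> 0}"
  shows "integrable lborel f"
proof -
  have "compact (closure {x. f x \<noteq> 0})"
    using assms(2) by simp
  then have "integrable lborel (\<lambda>x. indicator (closure {x. f x \<noteq> 0}) x *\<^sub>R f x)"
    by (rule borel_integrable_compact) (rule continuous_on_subset[OF assms(1)], simp)
  moreover have "(\<lambda>x. indicator (closure {x. f x \<noteq> 0}) x *\<^sub>R f x) = f"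
  proof
    show "indicator (closure {x. f x \<noteq> 0}) x *\<^sub>R f x = f x" for x
      using closure_subset[of "{x. f x \<noteq> 0}"] by (cases "f x = 0") auto
  qed
  ultimately show ?thesis by simp
qed

lemma integral_lborel_translate:
  fixes f :: "'a::euclidean_space \<Rightarrow> real"
  assumes "f \<in> borel_measurable borel"
  shows "(LINT y|lborel. f (y + c)) = (LINT y|lborel. f y)"
proof -
  have "(LINT y|distr lborel borel ((+) c). f y) = (LINT y|lborel. f (c + y))"
    using assms by (intro integral_distr) auto
  then show ?thesis
    by (simp add: lborel_distr_plus add.commute)
qed

text \<open>
  Translation invariance makes the integral of every difference quotient vanish, and the difference
  quotients converge to the partial derivative under a common bound.
\<close>

lemma integral_partial_deriv_eq_0:
  fixes w :: "real ^ 'n \<Rightarrow> real"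
  assumes w: "Ck 1 w" and bdd: "bounded {x. w x \<noteq> 0}"
  shows "(LINT y|lborel. partial_deriv i w y) = 0"
proof -
  have dw: "w differentiable_on UNIV" and cw: "continuous_on UNIV w"
    and cd: "continuous_on UNIV (partial_deriv i w)"
    using w by (auto intro: differentiable_imp_continuous_on)
  have [measurable]: "w \<in> borel_measurable borel" "partial_deriv i w \<in> borel_measurable borel"
    using cw cd by (auto intro: borel_measurable_continuous_onI)
  have int_w: "integrable lborel w"
    by (rule integrable_continuous_bounded_support[OF cw bdd])
  obtain R where R: "\<And>y. w y \<noteq> 0 \<Longrightarrow> norm y \<le> R"
    using bdd by (auto simp: bounded_iff)
  have "bounded (partial_deriv i w ` cball 0 (R + 2))"
    by (intro compact_imp_bounded compact_continuous_image continuous_on_subset[OF cd]) auto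
  then obtain M where M: "\<And>y. norm y \<le> R + 2 \<Longrightarrow> \<bar>partial_deriv i w y\<bar> \<le> M"
    unfolding bounded_iff by (metis imageI mem_cball_0 real_norm_def)
  define t where "t n = inverse (real (Suc n))" for n
  have t: "0 < t n" "t n \<le> 1" for n
    by (auto simp: t_def inverse_le_1_iff)
  define s where "s n y = (w (y + t n *\<^sub>R axis i 1) - w y) / t n" for n y
  have "(\<lambda>n. LINT y|lborel. s n y) \<longlonglongrightarrow> (LINT y|lborel. partial_deriv i w y)"
  proof (rule integral_dominated_convergence)
    show "integrable lborel (\<lambda>y. M * indicator (cball (0::real ^ 'n) (R + 1)) y)"
      using emeasure_lborel_cball_finite[of "0 :: real ^ 'n" "R + 1"]
      by (intro integrable_mult_right integrable_real_indicator) auto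
    show "AE y in lborel. (\<lambda>n. s n y) \<longlonglongrightarrow> partial_deriv i w y"
    proof (rule AE_I2)
      fix y
      have "((\<lambda>h. (w (y + (0 + h) *\<^sub>R axis i 1) - w (y + 0 *\<^sub>R axis i 1)) / h)
        \<longlongrightarrow> partial_deriv i w (y + 0 *\<^sub>R axis i 1)) (at 0)"
        using has_real_derivative_partial[OF dw, of y i 0] unfolding DERIV_def .
      then have lim: "((\<lambda>h. (w (y + h *\<^sub>R axis i 1) - w y) / h) \<longlongrightarrow> partial_deriv i w y) (at 0)"
        by simp
      have "filterlim t (at 0) sequentially"
        unfolding filterlim_at
      proof
        show "t \<longlonglongrightarrow> 0"
          using LIMSEQ_inverse_real_of_nat unfolding t_def[abs_def] .
        show "eventually (\<lambda>n. t n \<in> UNIV \<and> t n \<noteq> 0) sequentially"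
          using t(1) by (auto simp: less_imp_neq[symmetric])
      qed
      then show "(\<lambda>n. s n y) \<longlonglongrightarrow> partial_deriv i w y"
        unfolding s_def by (rule filterlim_compose[OF lim])
    qed
    show "AE y in lborel. norm (s n y) \<le> M * indicator (cball 0 (R + 1)) y" for n
    proof (rule AE_I2)
      fix y
      show "norm (s n y) \<le> M * indicator (cball 0 (R + 1)) y"
      proof (cases "norm y \<le> R + 1")
        case True
        have "\<exists>z. 0 < z \<and> z < t n \<and> w (y + t n *\<^sub>R axis i 1) - w (y + 0 *\<^sub>R axis i 1) =
          (t n - 0) * partial_deriv i w (y + z *\<^sub>R axis i 1)"
          by (rule MVT2[OF t(1)]) (rule has_real_derivative_partial[OF dw])
        then obtain z where z: "0 < z" "z < t n" "s n y = partial_deriv i w (y + z *\<^sub>R axis i 1)"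
          using t(1)[of n] by (auto simp: s_def)
        have "norm (y + z *\<^sub>R axis i 1) \<le> norm y + norm (z *\<^sub>R axis i (1::real) :: real ^ 'n)"
          by (rule norm_triangle_ineq)
        also have "\<dots> \<le> R + 2"
          using True z t(2)[of n] by simp
        finally show ?thesis
          using M True z(3) by simp
      next
        case False
        have "norm y \<le> norm (y + t n *\<^sub>R axis i 1) + norm (t n *\<^sub>R axis i (1::real) :: real ^ 'n)"
          using norm_triangle_ineq4[of "y + t n *\<^sub>R axis i 1" "t n *\<^sub>R axis i 1"] by simp
        then have "norm (y + t n *\<^sub>R axis i 1) > R"
          using False t[of n] by simp
        then have "w (y + t n *\<^sub>R axis i 1) = 0" "w y = 0"
          using R[of y] R[of "y + t n *\<^sub>R axis i 1"] False by force+
        then show ?thesis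
          using False by (simp add: s_def)
      qed
    qed
  qed (auto simp: s_def)
  moreover have "(LINT y|lborel. s n y) = 0" for n
  proof -
    have "bounded ((\<lambda>y. - (t n *\<^sub>R axis i 1) + y) ` {x. w x \<noteq> 0})"
      by (rule bounded_translation[OF bdd])
    moreover have "{y. w (y + t n *\<^sub>R axis i 1) \<noteq> 0} \<subseteq> (\<lambda>y. - (t n *\<^sub>R axis i 1) + y) ` {x. w x \<noteq> 0}"
      by (auto intro!: image_eqI[of _ _ "_ + t n *\<^sub>R axis i 1"])
    ultimately have "integrable lborel (\<lambda>y. w (y + t n *\<^sub>R axis i 1))"
      by (intro integrable_continuous_bounded_support continuous_on_compose2[OF cw])
        (auto intro: continuous_intros bounded_subset)
    then show ?thesis
      using int_w by (simp add: s_def integral_lborel_translate)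
  qed
  ultimately show ?thesis
    by (simp add: LIMSEQ_const_iff)
qed

lemma Cc_infinity_bounded: "Cc_infinity f \<Longrightarrow> bounded {x. f x \<noteq> 0}"
  unfolding Cc_infinity_def
  using bounded_subset[OF compact_imp_bounded closure_subset] by blast

lemma bounded_support_partial_deriv:
  assumes "bounded {x. f x \<noteq> 0}"
  shows "bounded {x. partial_deriv i f x \<noteq> 0}"
proof (rule bounded_subset[OF bounded_closure[OF assms]], rule ccontr)
  assume "\<not> {x. partial_deriv i f x \<noteq> 0} \<subseteq> closure {x. f x \<noteq> 0}"
  then obtain x where x: "partial_deriv i f x \<noteq> 0" "x \<in> - closure {x. f x \<noteq> 0}"
    by blast
  have "eventually (\<lambda>y. y \<in> - closure {x. f x \<noteq> 0}) (nhds x)"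
    using x(2) by (intro eventually_nhds_in_open) auto
  then have "eventually (\<lambda>y. 0 = f y) (nhds x)"
    by eventually_elim (use closure_subset[of "{x. f x \<noteq> 0}"] in auto)
  then have "(f has_derivative (\<lambda>_. 0)) (at x)"
    using has_derivative_transform_eventually[of "\<lambda>_. 0" "\<lambda>_. 0" x UNIV f]
    by (auto simp: eventually_nhds_conv_at)
  from partial_deriv_eq[OF this, of i] x(1) show False by simp
qed

lemma Cc_infinity_partial_deriv:
  assumes "Cc_infinity f"
  shows "Cc_infinity (partial_deriv i f)"
proof -
  have "Ck k (partial_deriv i f)" for k
    using assms[unfolded Cc_infinity_def, THEN conjunct1, rule_format, of "Suc k"] by simp
  then show ?thesis
    using bounded_support_partial_deriv[OF Cc_infinity_bounded[OF assms]]
    by (simp add: Cc_infinity_def)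
qed

lemma integrable_mult_Cc_infinity:
  assumes "continuous_on UNIV f" "Cc_infinity \<phi>"
  shows "integrable lborel (\<lambda>y. f y * \<phi> y)"
proof (rule integrable_continuous_bounded_support)
  have "continuous_on UNIV \<phi>"
    using assms(2) Ck_imp_continuous by (auto simp: Cc_infinity_def)
  then show "continuous_on UNIV (\<lambda>y. f y * \<phi> y)"
    using assms(1) by (intro continuous_intros)
  show "bounded {y. f y * \<phi> y \<noteq> 0}"
    by (rule bounded_subset[OF Cc_infinity_bounded[OF assms(2)]]) auto
qed

lemma integral_by_parts_partial_deriv:
  assumes u: "Ck 1 u" and \<phi>: "Cc_infinity \<phi>"
  shows "(LINT y|lborel. u y * partial_deriv i \<phi> y) = - (LINT y|lborel. partial_deriv i u y * \<phi> y)"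
proof -
  have \<phi>1: "Ck 1 \<phi>"
    using \<phi> by (simp only: Cc_infinity_def)
  have "(LINT y|lborel. partial_deriv i (\<lambda>y. u y * \<phi> y) y) = 0"
    by (rule integral_partial_deriv_eq_0[OF Ck_mult[OF u \<phi>1]],
        rule bounded_subset[OF Cc_infinity_bounded[OF \<phi>]]) auto
  moreover have "integrable lborel (\<lambda>y. u y * partial_deriv i \<phi> y)"
    by (rule integrable_mult_Cc_infinity[OF Ck_imp_continuous[OF u] Cc_infinity_partial_deriv[OF \<phi>]])
  moreover have "integrable lborel (\<lambda>y. partial_deriv i u y * \<phi> y)"
    using u by (intro integrable_mult_Cc_infinity[OF _ \<phi>]) simp
  ultimately show ?thesis
    using u \<phi>1 by (simp add: partial_deriv_mult)
qed

section \<open>Weakly divergence-free fields\<close>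

lemma density_points_mono:
  assumes "E \<subseteq> F"
  shows "density_points m E \<subseteq> density_points m F"
proof
  fix x assume x: "x \<in> density_points m E"
  have le: "outer_measure_of lebesgue (ball x r - F) / ennreal (r powr m) \<le>
      outer_measure_of lebesgue (ball x r - E) / ennreal (r powr m)" for r
    using assms by (intro divide_right_mono_ennreal outer_measure_of_mono) auto
  have "((\<lambda>r. outer_measure_of lebesgue (ball x r - F) / ennreal (r powr m)) \<longlongrightarrow> 0) (at_right 0)"
    by (rule tendsto_sandwich[OF _ _ tendsto_const x[unfolded density_points_def mem_Collect_eq]])
      (simp_all add: le)
  then show "x \<in> density_points m F"
    by (simp add: density_points_def)
qed

lemma density_point_measure_less:
  assumes x: "x \<in> density_points m E" and E: "closed E" and e: "0 < e"
  shows "eventually (\<lambda>r. measure lborel (ball x r - E) < e * r powr m) (at_right 0)"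
proof -
  have "eventually (\<lambda>r. outer_measure_of lebesgue (ball x r - E) / ennreal (r powr m) < ennreal e) (at_right 0)"
    using x e unfolding density_points_def by (intro order_tendstoD(2)) auto
  moreover have "eventually (\<lambda>r::real. 0 < r) (at_right 0)"
    by (rule eventually_at_right_less)
  ultimately show ?thesis
  proof eventually_elim
    case (elim r)
    have Z: "ball x r - E \<in> sets borel"
      using E by auto
    have "emeasure lborel (ball x r - E) \<le> emeasure lborel (ball x r)"
      using E by (intro emeasure_mono) auto
    also have "\<dots> < \<infinity>"
      by (rule emeasure_lborel_ball_finite)
    finally have "emeasure lborel (ball x r - E) = ennreal (measure lborel (ball x r - E))"
      by (intro emeasure_eq_ennreal_measure) auto
    moreover have "outer_measure_of lebesgue (ball x r - E) = emeasure lborel (ball x r - E)"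
      using Z by simp
    ultimately have "ennreal (measure lborel (ball x r - E) / r powr m) < ennreal e"
      using elim by (simp add: divide_ennreal)
    then have "measure lborel (ball x r - E) / r powr m < e"
      using e by (simp add: ennreal_less_iff)
    then show ?case
      using elim(2) by (simp add: pos_divide_less_eq)
  qed
qed

text \<open>
  If the divergence of \<open>u\<close> were nonzero at \<open>x\<close>, then integrating it against a bump of radius \<open>r\<close> would
  give at least a multiple of \<open>r\<^sup>n\<close>. As \<open>v\<close> is weakly divergence-free, the same integral equals that of
  \<open>v - u\<close> against the gradient of the bump; this is at most \<open>4 M / r\<close> times the measure of the part of
  the ball on which \<open>u\<close> and \<open>v\<close> differ. So that measure would be at least a multiple of
  \<open>r\<^sup>n\<^sup>+\<^sup>1\<close>, which the density assumption excludes.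
\<close>

lemma divergence_eq_0_at_density_point:
  fixes u v :: "'n::finite \<Rightarrow> real ^ 'n \<Rightarrow> real"
  assumes v: "\<And>i. continuous_on UNIV (v i)" and u: "\<And>i. Ck 1 (u i)"
    and weak: "\<And>\<phi>. Cc_infinity \<phi> \<Longrightarrow>
      (LINT y|lborel. (\<Sum>i\<in>UNIV. v i y * partial_deriv i \<phi> y)) = 0"
    and x: "x \<in> density_points (real CARD('n) + 1) {y. \<forall>i. v i y = u i y}"
  shows "(\<Sum>i\<in>UNIV. partial_deriv i (u i) x) = 0"
proof (rule ccontr)
  define g where "g y = (\<Sum>i\<in>UNIV. partial_deriv i (u i) y)" for y
  define E where "E = {y. \<forall>i. v i y = u i y}"
  assume "(\<Sum>i\<in>UNIV. partial_deriv i (u i) x) \<noteq> 0"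
  then have gx: "g x \<noteq> 0" by (simp add: g_def)
  have cu: "continuous_on UNIV (u i)" for i
    by (rule Ck_imp_continuous[OF u])
  have cdu: "continuous_on UNIV (partial_deriv i (u i))" for i
    using u[of i] by simp
  have cg: "continuous_on UNIV g"
    unfolding g_def[abs_def] by (intro continuous_on_sum cdu)
  have E: "closed E"
  proof -
    have "E = (\<Inter>i. {y. v i y = u i y})"
      by (auto simp: E_def)
    moreover have "closed {y. v i y = u i y}" for i
      using v[of i] cu[of i] by (rule closed_Collect_eq)
    ultimately show ?thesis by auto
  qed
  define s where "s = sgn (g x)"
  define a where "a = \<bar>g x\<bar> / 2"
  have s: "\<bar>s\<bar> = 1" and a: "0 < a" and sa: "a < s * g x"
    using gx by (auto simp: s_def a_def sgn_real_def)
  \<comment> \<open>near \<open>x\<close> the divergence of \<open>u\<close> keeps its sign and stays away from \<open>0\<close>\<close>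
  have "open {y. a < s * g y}"
    by (intro open_Collect_less continuous_intros cg)
  then obtain r0 where r0: "0 < r0" "ball x r0 \<subseteq> {y. a < s * g y}"
    using sa open_contains_ball[of "{y. a < s * g y}"] by blast
  have "continuous_on UNIV (\<lambda>y. \<Sum>i\<in>UNIV. \<bar>v i y - u i y\<bar>)"
    by (intro continuous_intros v cu)
  then have "bounded ((\<lambda>y. \<Sum>i\<in>UNIV. \<bar>v i y - u i y\<bar>) ` cball x 1)"
    by (intro compact_imp_bounded compact_continuous_image) (auto intro: continuous_on_subset)
  then obtain M where M: "0 < M" "\<And>y. y \<in> cball x 1 \<Longrightarrow> (\<Sum>i\<in>UNIV. \<bar>v i y - u i y\<bar>) \<le> M"
    unfolding bounded_pos by (fastforce simp: sum_nonneg)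
  \<comment> \<open>on the ball of radius \<open>r / 2\<close> the bump is at least \<open>exp (- 2)\<close>; \<open>c * r ^ n\<close> is the
    resulting lower bound for the integral\<close>
  define c where "c = a * exp (- 2) * measure lborel (ball (0 :: real ^ 'n) 1) / 2 ^ CARD('n)"
  have c: "0 < c"
    using a by (simp add: c_def content_ball_pos)
  have lower: "c * r ^ (CARD('n) + 1) \<le> 4 * M * measure lborel (ball x r - E)"
    if r: "0 < r" "r < r0" "r \<le> 1" for r
  proof -
    let ?b = "bump x r"
    have b: "Cc_infinity ?b"
      by (rule Cc_infinity_bump[OF r(1)])
    have fin: "emeasure lborel (ball x t - F) < \<infinity>" for t F
    proof -
      have "emeasure lborel (ball x t - F) \<le> emeasure lborel (ball x t)"
        by (intro emeasure_mono) auto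
      then show ?thesis
        using emeasure_lborel_ball_finite[of x t] by (rule order.strict_trans1)
    qed
    have int_uv: "integrable lborel (\<lambda>y. f i y * partial_deriv i ?b y)"
      if "\<And>i. continuous_on UNIV (f i)" for f :: "'n \<Rightarrow> real ^ 'n \<Rightarrow> real" and i
      by (rule integrable_mult_Cc_infinity[OF that Cc_infinity_partial_deriv[OF b]])
    have "(LINT y|lborel. g y * ?b y) = (\<Sum>i\<in>UNIV. LINT y|lborel. partial_deriv i (u i) y * ?b y)"
      unfolding g_def sum_distrib_right
      by (intro Bochner_Integration.integral_sum integrable_mult_Cc_infinity[OF cdu b])
    also have "\<dots> = - (\<Sum>i\<in>UNIV. LINT y|lborel. u i y * partial_deriv i ?b y)"
      by (simp add: integral_by_parts_partial_deriv[OF u b] sum_negf)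
    also have "\<dots> = (LINT y|lborel. (\<Sum>i\<in>UNIV. v i y * partial_deriv i ?b y))
        - (LINT y|lborel. (\<Sum>i\<in>UNIV. u i y * partial_deriv i ?b y))"
    proof -
      have "(LINT y|lborel. (\<Sum>i\<in>UNIV. u i y * partial_deriv i ?b y)) =
        (\<Sum>i\<in>UNIV. LINT y|lborel. u i y * partial_deriv i ?b y)"
        by (intro Bochner_Integration.integral_sum int_uv cu)
      then show ?thesis
        by (simp add: weak[OF b])
    qed
    also have "\<dots> = (LINT y|lborel. (\<Sum>i\<in>UNIV. v i y * partial_deriv i ?b y)
        - (\<Sum>i\<in>UNIV. u i y * partial_deriv i ?b y))"
      by (intro Bochner_Integration.integral_diff[symmetric] Bochner_Integration.integrable_sum
          int_uv v cu)
    also have "\<dots> = (LINT y|lborel. (\<Sum>i\<in>UNIV. (v i y - u i y) * partial_deriv i ?b y))"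
      by (simp add: left_diff_distrib sum_subtractf)
    finally have eq: "(LINT y|lborel. g y * ?b y) =
      (LINT y|lborel. (\<Sum>i\<in>UNIV. (v i y - u i y) * partial_deriv i ?b y))" .
    have int_g: "integrable lborel (\<lambda>y. g y * ?b y)"
      by (rule integrable_mult_Cc_infinity[OF cg b])
    have cont_ball: "measure lborel (ball x (r / 2)) = r ^ CARD('n) / 2 ^ CARD('n) * measure lborel (ball (0 :: real ^ 'n) 1)"
      using content_ball_conv_unit_ball[of "r / 2" x] r(1) by (simp add: power_divide)
    have "c * r ^ CARD('n) = (LINT y|lborel. a * exp (- 2) * indicator (ball x (r / 2)) y)"
      by (simp add: c_def cont_ball)
    also have "\<dots> \<le> (LINT y|lborel. s * (g y * ?b y))"
    proof (rule integral_mono)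
      show "integrable lborel (\<lambda>y. a * exp (- 2) * indicator (ball x (r / 2)) y)"
        using fin[of "r / 2" "{}"] by (intro integrable_mult_right integrable_real_indicator) auto
      show "integrable lborel (\<lambda>y. s * (g y * ?b y))"
        using int_g by simp
      fix y
      show "a * exp (- 2) * indicator (ball x (r / 2)) y \<le> s * (g y * ?b y)"
      proof (cases "y \<in> ball x r")
        case True
        then have "y \<in> ball x r0"
          using r(2) by simp
        then have "a < s * g y"
          using r0(2) by blast
        then have ag: "a \<le> s * g y"
          by simp
        show ?thesis
        proof (cases "y \<in> ball x (r / 2)")
          case True
          then have "a * exp (- 2) \<le> (s * g y) * ?b y"
            using ag a bump_ge[OF r(1) True] by (intro mult_mono) auto
          then show ?thesis
            using True by (simp add: mult.assoc)
        next
          case False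
          then show ?thesis
            using ag a mult_nonneg_nonneg[of "s * g y" "?b y"] bump_nonneg[OF r(1), of x y]
            by (simp add: mult.assoc)
        qed
      next
        case False
        then show ?thesis
          using r(1) by (simp add: bump_eq_0)
      qed
    qed
    also have "\<dots> \<le> \<bar>LINT y|lborel. g y * ?b y\<bar>"
      using s abs_ge_self[of "s * (LINT y|lborel. g y * ?b y)"] by (simp add: abs_mult)
    also have "\<dots> \<le> (LINT y|lborel. M * (4 / r) * indicator (ball x r - E) y)"
      unfolding eq
    proof (rule order_trans[OF integral_abs_bound integral_mono])
      have diff: "integrable lborel (\<lambda>y. \<Sum>i\<in>UNIV. (v i y - u i y) * partial_deriv i ?b y)"
        by (intro Bochner_Integration.integrable_sum int_uv continuous_intros v cu)
      then show "integrable lborel (\<lambda>y. \<bar>\<Sum>i\<in>UNIV. (v i y - u i y) * partial_deriv i ?b y\<bar>)"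
        by simp
      show "integrable lborel (\<lambda>y. M * (4 / r) * indicator (ball x r - E) y)"
        using fin[of r E] E by (intro integrable_mult_right integrable_real_indicator) auto
      fix y
      show "\<bar>\<Sum>i\<in>UNIV. (v i y - u i y) * partial_deriv i ?b y\<bar> \<le> M * (4 / r) * indicator (ball x r - E) y"
      proof (cases "y \<in> ball x r - E")
        case True
        have "\<bar>\<Sum>i\<in>UNIV. (v i y - u i y) * partial_deriv i ?b y\<bar> \<le>
            (\<Sum>i\<in>UNIV. \<bar>v i y - u i y\<bar> * \<bar>partial_deriv i ?b y\<bar>)"
          using sum_abs[of "\<lambda>i. (v i y - u i y) * partial_deriv i ?b y" UNIV] by (simp add: abs_mult)
        also have "\<dots> \<le> (\<Sum>i\<in>UNIV. \<bar>v i y - u i y\<bar> * (4 / r))"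
          by (intro sum_mono mult_left_mono abs_partial_deriv_bump_le r) auto
        also have "\<dots> = (\<Sum>i\<in>UNIV. \<bar>v i y - u i y\<bar>) * (4 / r)"
          by (rule sum_distrib_right[symmetric])
        also have "\<dots> \<le> M * (4 / r)"
          using True r by (intro mult_right_mono M(2)) auto
        finally show ?thesis
          using True by simp
      next
        case False
        then have "y \<in> E \<or> y \<notin> ball x r" by blast
        then have "(v i y - u i y) * partial_deriv i ?b y = 0" for i
          using partial_deriv_bump_eq_0[OF r(1)] by (auto simp: E_def)
        then have "(\<Sum>i\<in>UNIV. (v i y - u i y) * partial_deriv i ?b y) = 0"
          by (intro sum.neutral) blast
        then show ?thesis
          using False by simp
      qed
    qed
    also have "\<dots> = M * (4 / r) * measure lborel (ball x r - E)"
      by simp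
    finally show ?thesis
      using r(1) by (simp add: field_simps)
  qed
  have "eventually (\<lambda>r. measure lborel (ball x r - E) < c / (4 * M) * r powr (real CARD('n) + 1)) (at_right 0)"
    by (rule density_point_measure_less[OF x[folded E_def] E]) (use c M in simp)
  moreover have "eventually (\<lambda>r. r \<in> {0<..<min r0 1}) (at_right 0)"
    using r0(1) by (intro eventually_at_right_real) auto
  ultimately have "eventually (\<lambda>r. False) (at_right (0::real))"
  proof eventually_elim
    case (elim r)
    then have "measure lborel (ball x r - E) < c / (4 * M) * r ^ (CARD('n) + 1)"
      by (simp add: powr_add powr_realpow mult_ac)
    then have "4 * M * measure lborel (ball x r - E) < c * r ^ (CARD('n) + 1)"
      using M(1) by (simp add: field_simps)
    then show False
      using lower[of r] elim(2) by auto
  qed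
  then show False by simp
qed

section \<open>Signs and the exterior derivative\<close>

lemma shuffle_sign_Un_left:
  assumes "\<alpha> \<inter> \<alpha>' = {}"
  shows "shuffle_sign (\<alpha> \<union> \<alpha>') \<beta> = shuffle_sign \<alpha> \<beta> * shuffle_sign \<alpha>' \<beta>"
proof -
  have "{(a, b). a \<in> \<alpha> \<union> \<alpha>' \<and> b \<in> \<beta> \<and> b < a} =
    {(a, b). a \<in> \<alpha> \<and> b \<in> \<beta> \<and> b < a} \<union> {(a, b). a \<in> \<alpha>' \<and> b \<in> \<beta> \<and> b < a}"
    by auto
  then have "card {(a, b). a \<in> \<alpha> \<union> \<alpha>' \<and> b \<in> \<beta> \<and> b < a} =
    card {(a, b). a \<in> \<alpha> \<and> b \<in> \<beta> \<and> b < a} + card {(a, b). a \<in> \<alpha>' \<and> b \<in> \<beta> \<and> b < a}"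
    using assms by (simp only:) (intro card_Un_disjoint, auto)
  then show ?thesis
    by (simp add: shuffle_sign_def power_add)
qed

lemma shuffle_sign_Un_right:
  assumes "\<beta> \<inter> \<beta>' = {}"
  shows "shuffle_sign \<alpha> (\<beta> \<union> \<beta>') = shuffle_sign \<alpha> \<beta> * shuffle_sign \<alpha> \<beta>'"
proof -
  have "{(a, b). a \<in> \<alpha> \<and> b \<in> \<beta> \<union> \<beta>' \<and> b < a} =
    {(a, b). a \<in> \<alpha> \<and> b \<in> \<beta> \<and> b < a} \<union> {(a, b). a \<in> \<alpha> \<and> b \<in> \<beta>' \<and> b < a}"
    by auto
  then have "card {(a, b). a \<in> \<alpha> \<and> b \<in> \<beta> \<union> \<beta>' \<and> b < a} =
    card {(a, b). a \<in> \<alpha> \<and> b \<in> \<beta> \<and> b < a} + card {(a, b). a \<in> \<alpha> \<and> b \<in> \<beta>' \<and> b < a}"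
    using assms by (simp only:) (intro card_Un_disjoint, auto)
  then show ?thesis
    by (simp add: shuffle_sign_def power_add)
qed

lemma shuffle_sign_square: "shuffle_sign \<alpha> \<beta> * shuffle_sign \<alpha> \<beta> = 1"
  by (simp add: shuffle_sign_def flip: power_mult_distrib)

text \<open>Each pair in \<open>\<alpha> \<times> \<beta>\<close> is an inversion in exactly one of the two orders.\<close>

lemma shuffle_sign_swap:
  assumes "\<alpha> \<inter> \<beta> = {}"
  shows "shuffle_sign \<beta> \<alpha> = (- 1) ^ (card \<alpha> * card \<beta>) * shuffle_sign \<alpha> \<beta>"
proof -
  have "\<alpha> \<times> \<beta> = {(a, b). a \<in> \<alpha> \<and> b \<in> \<beta> \<and> b < a} \<union> prod.swap ` {(b, a). b \<in> \<beta> \<and> a \<in> \<alpha> \<and> a < b}"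
    using assms by (auto simp: image_iff not_less_iff_gr_or_eq)
  then have "card (\<alpha> \<times> \<beta>) = card {(a, b). a \<in> \<alpha> \<and> b \<in> \<beta> \<and> b < a} +
      card (prod.swap ` {(b, a). b \<in> \<beta> \<and> a \<in> \<alpha> \<and> a < b})"
    by (simp only:) (intro card_Un_disjoint, auto)
  also have "card (prod.swap ` {(b, a). b \<in> \<beta> \<and> a \<in> \<alpha> \<and> a < b}) = card {(b, a). b \<in> \<beta> \<and> a \<in> \<alpha> \<and> a < b}"
    by (intro card_image) simp
  finally have "shuffle_sign \<alpha> \<beta> * shuffle_sign \<beta> \<alpha> = (- 1) ^ (card \<alpha> * card \<beta>)"
    by (simp add: shuffle_sign_def card_cartesian_product flip: power_add)
  moreover have "shuffle_sign \<beta> \<alpha> =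
      shuffle_sign \<alpha> \<beta> * (shuffle_sign \<alpha> \<beta> * shuffle_sign \<beta> \<alpha>)"
    by (simp add: shuffle_sign_square flip: mult.assoc)
  ultimately show ?thesis
    by (simp add: mult.commute)
qed

lemma wedge_component:
  "wedge u v $ \<gamma> = (\<Sum>\<alpha>\<in>Pow \<gamma>. shuffle_sign \<alpha> (\<gamma> - \<alpha>) * u $ \<alpha> * v $ (\<gamma> - \<alpha>))"
  by (simp add: wedge_def)

lemma ext_deriv_component:
  "ext_deriv f x $ \<gamma> =
    (\<Sum>i\<in>\<gamma>. shuffle_sign {i} (\<gamma> - {i}) * partial_deriv i (\<lambda>y. f y $ (\<gamma> - {i})) x)"
proof -
  have "wedge (axis {i} 1) (\<chi> \<alpha>. partial_deriv i (\<lambda>y. f y $ \<alpha>) x) $ \<gamma> =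
    (if i \<in> \<gamma> then shuffle_sign {i} (\<gamma> - {i}) * partial_deriv i (\<lambda>y. f y $ (\<gamma> - {i})) x else 0)" for i
  proof -
    have "wedge (axis {i} 1) (\<chi> \<alpha>. partial_deriv i (\<lambda>y. f y $ \<alpha>) x) $ \<gamma> =
      (\<Sum>\<alpha>\<in>Pow \<gamma>. if \<alpha> = {i} then shuffle_sign {i} (\<gamma> - {i}) *
        partial_deriv i (\<lambda>y. f y $ (\<gamma> - {i})) x else 0)"
      unfolding wedge_component by (intro sum.cong) (auto simp: axis_def)
    then show ?thesis
      by (simp add: sum.delta)
  qed
  then have "ext_deriv f x $ \<gamma> = (\<Sum>i\<in>UNIV. if i \<in> \<gamma> then shuffle_sign {i} (\<gamma> - {i}) *
      partial_deriv i (\<lambda>y. f y $ (\<gamma> - {i})) x else 0)"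
    by (simp add: ext_deriv_def sum_component)
  then show ?thesis
    by (simp add: sum.If_cases)
qed

lemma of_degree_ext_deriv:
  fixes f :: "('n::{finite,linorder}) form"
  assumes "of_degree k f"
  shows "of_degree (Suc k) (ext_deriv f)"
  unfolding of_degree_def
proof (intro allI impI)
  fix x :: "(real, 'n) vec" and \<gamma> :: "'n set" assume "card \<gamma> \<noteq> Suc k"
  then have "card (\<gamma> - {i}) \<noteq> k" if "i \<in> \<gamma>" for i
    using that card_Suc_Diff1[of \<gamma> i] by auto
  then have "(\<lambda>y. f y $ (\<gamma> - {i})) = (\<lambda>y. 0)" if "i \<in> \<gamma>" for i
    using assms that by (auto simp: of_degree_def)
  then show "ext_deriv f x $ \<gamma> = 0"
    by (simp add: ext_deriv_component partial_deriv_const)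
qed

text \<open>
  The double sum over \<open>i\<close> and \<open>j\<close> is antisymmetric: exchanging the two indices flips the sign of
  \<open>dx\<^sub>i \<and> dx\<^sub>j\<close> and leaves the mixed derivative unchanged.
\<close>

lemma ext_deriv_ext_deriv:
  assumes f: "\<And>\<alpha>. Ck 2 (\<lambda>x. f x $ \<alpha>)"
  shows "ext_deriv (ext_deriv f) x = 0"
proof -
  define T where "T \<gamma> j i = shuffle_sign {j} (\<gamma> - {j}) * shuffle_sign {i} (\<gamma> - {j, i}) *
    partial_deriv j (partial_deriv i (\<lambda>y. f y $ (\<gamma> - {j, i}))) x" for \<gamma> j i
  have dd: "partial_deriv i (\<lambda>y. f y $ \<alpha>) differentiable_on UNIV" for i \<alpha>
    using f[of \<alpha>] by (simp add: numeral_2_eq_2)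
  have T: "T \<gamma> j i = - T \<gamma> i j" if "i \<in> \<gamma>" "j \<in> \<gamma>" "i \<noteq> j" for \<gamma> i j
  proof -
    define \<delta> where "\<delta> = \<gamma> - {i, j}"
    have e: "\<gamma> - {j, i} = \<delta>" "\<gamma> - {i, j} = \<delta>" "\<gamma> - {j} = {i} \<union> \<delta>" "\<gamma> - {i} = {j} \<union> \<delta>"
      using that by (auto simp: \<delta>_def)
    have d: "{i} \<inter> \<delta> = {}" "{j} \<inter> \<delta> = {}"
      by (auto simp: \<delta>_def)
    have sw: "shuffle_sign {j} {i} = - shuffle_sign {i} {j}"
      using shuffle_sign_swap[of "{i}" "{j}"] that by simp
    show ?thesis
      unfolding T_def e shuffle_sign_Un_right[OF d(1)] shuffle_sign_Un_right[OF d(2)] sw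
        mixed_partial_deriv_commute[OF f, of j i]
      by simp
  qed
  have "ext_deriv (ext_deriv f) x $ \<gamma> = 0" for \<gamma>
  proof -
    let ?S = "\<Sum>j\<in>\<gamma>. \<Sum>i\<in>\<gamma>. if i = j then 0 else T \<gamma> j i"
    have "ext_deriv (ext_deriv f) x $ \<gamma> = (\<Sum>j\<in>\<gamma>. \<Sum>i\<in>\<gamma> - {j}. T \<gamma> j i)"
      unfolding ext_deriv_component[of "ext_deriv f"] ext_deriv_component[of f]
      by (simp add: partial_deriv_sum partial_deriv_cmult differentiable_on_mult dd
          sum_distrib_left T_def mult.assoc flip: Diff_insert2)
    also have "\<dots> = ?S"
      by (intro sum.cong refl sum.mono_neutral_cong_left) auto
    finally have eq: "ext_deriv (ext_deriv f) x $ \<gamma> = ?S" .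
    have "?S = (\<Sum>i\<in>\<gamma>. \<Sum>j\<in>\<gamma>. if i = j then 0 else T \<gamma> j i)"
      by (rule sum.swap)
    also have "\<dots> = (\<Sum>i\<in>\<gamma>. \<Sum>j\<in>\<gamma>. - (if j = i then 0 else T \<gamma> i j))"
    proof (intro sum.cong refl)
      fix i j assume "i \<in> \<gamma>" "j \<in> \<gamma>"
      then show "(if i = j then 0 else T \<gamma> j i) = - (if j = i then 0 else T \<gamma> i j)"
        using T[of i \<gamma> j] by simp
    qed
    also have "\<dots> = - ?S"
      by (simp add: sum_negf)
    finally show ?thesis
      unfolding eq by simp
  qed
  then show ?thesis
    by (simp add: vec_eq_iff)
qed

lemma Cc_infinity_0: "Cc_infinity (\<lambda>x. 0)"
  by (simp add: Cc_infinity_def Ck_const)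

lemma Cc_infinity_cmult:
  assumes "Cc_infinity f"
  shows "Cc_infinity (\<lambda>x. c * f x)"
proof -
  have "bounded {x. c * f x \<noteq> 0}"
    by (rule bounded_subset[OF Cc_infinity_bounded[OF assms]]) auto
  then show ?thesis
    using assms by (auto simp: Cc_infinity_def intro!: Ck_mult Ck_const)
qed

lemma Cc_infinity_sum:
  assumes "finite A" "\<And>a. a \<in> A \<Longrightarrow> Cc_infinity (f a)"
  shows "Cc_infinity (\<lambda>x. \<Sum>a\<in>A. f a x)"
proof -
  have "{x. (\<Sum>a\<in>A. f a x) \<noteq> 0} \<subseteq> (\<Union>a\<in>A. {x. f a x \<noteq> 0})"
    by (auto dest: sum.not_neutral_contains_not_neutral)
  moreover have "bounded (\<Union>a\<in>A. {x. f a x \<noteq> 0})"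
    using assms by (auto intro: Cc_infinity_bounded)
  ultimately have "bounded {x. (\<Sum>a\<in>A. f a x) \<noteq> 0}"
    by (rule bounded_subset[rotated])
  then show ?thesis
    using assms by (auto simp: Cc_infinity_def intro!: Ck_sum)
qed

lemma Cc_infinity_form_ext_deriv:
  assumes "Cc_infinity_form k f"
  shows "Cc_infinity_form (Suc k) (ext_deriv f)"
  using assms of_degree_ext_deriv
  by (auto simp: Cc_infinity_form_def ext_deriv_component
      intro!: Cc_infinity_sum Cc_infinity_cmult Cc_infinity_partial_deriv)

text \<open>
  Up to a sign that is the same for all \<open>i\<close>, pairing with \<open>d (\<phi> dx\<^sub>\<beta>)\<close>, where \<open>\<beta>\<close> is the complement
  of \<open>\<gamma>\<close>, pairs the gradient of \<open>\<phi>\<close> with the field whose divergence is the \<open>\<gamma>\<close>-component of the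
  exterior derivative.
\<close>

lemma wedge_ext_deriv_complementary_basis:
  fixes u :: "('n::{finite,linorder}) covector"
  shows "wedge u (ext_deriv (\<lambda>y. \<phi> y *\<^sub>R axis (- \<gamma>) 1) x) $ UNIV =
    shuffle_sign \<gamma> (- \<gamma>) * (- 1) ^ (card \<gamma> - 1) *
    (\<Sum>i\<in>\<gamma>. shuffle_sign {i} (\<gamma> - {i}) * u $ (\<gamma> - {i}) * partial_deriv i \<phi> x)"
proof -
  define K where "K i = shuffle_sign (\<gamma> - {i}) (- (\<gamma> - {i})) * shuffle_sign {i} (- \<gamma>) *
    (u $ (\<gamma> - {i}) * partial_deriv i \<phi> x)" for i
  have p: "partial_deriv i (\<lambda>y. (\<phi> y *\<^sub>R axis (- \<gamma>) 1) $ \<delta>) x =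
    (if \<delta> = - \<gamma> then partial_deriv i \<phi> x else 0)" for i \<delta>
    by (cases "\<delta> = - \<gamma>") (simp_all add: axis_def partial_deriv_const)
  have "wedge u (ext_deriv (\<lambda>y. \<phi> y *\<^sub>R axis (- \<gamma>) 1) x) $ UNIV =
    (\<Sum>\<alpha>\<in>UNIV. \<Sum>i\<in>- \<alpha>. shuffle_sign \<alpha> (- \<alpha>) * u $ \<alpha> *
      (shuffle_sign {i} (- \<alpha> - {i}) * (if - \<alpha> - {i} = - \<gamma> then partial_deriv i \<phi> x else 0)))"
    unfolding wedge_component ext_deriv_component p
    by (simp add: sum_distrib_left Compl_eq_Diff_UNIV[symmetric])
  \<comment> \<open>a term survives only if \<open>\<alpha>\<close> arises from \<open>\<gamma>\<close> by removing \<open>i\<close>\<close>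
  also have "\<dots> = (\<Sum>\<alpha>\<in>UNIV. \<Sum>i\<in>UNIV. if i \<in> \<gamma> \<and> \<alpha> = \<gamma> - {i} then K i else 0)"
  proof (rule sum.cong[OF refl], rule sum.mono_neutral_cong_left)
    fix \<alpha> i
    have iff: "i \<in> - \<alpha> \<and> - \<alpha> - {i} = - \<gamma> \<longleftrightarrow> i \<in> \<gamma> \<and> \<alpha> = \<gamma> - {i}"
      by blast
    show "shuffle_sign \<alpha> (- \<alpha>) * u $ \<alpha> *
      (shuffle_sign {i} (- \<alpha> - {i}) * (if - \<alpha> - {i} = - \<gamma> then partial_deriv i \<phi> x else 0)) =
      (if i \<in> \<gamma> \<and> \<alpha> = \<gamma> - {i} then K i else 0)" if "i \<in> - \<alpha>"
    proof (cases "- \<alpha> - {i} = - \<gamma>")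
      case True
      then have "i \<in> \<gamma> \<and> \<alpha> = \<gamma> - {i}"
        using iff that by blast
      then show ?thesis
        using True by (simp add: K_def)
    next
      case False
      then show ?thesis
        using iff by auto
    qed
  qed auto
  also have "\<dots> = (\<Sum>i\<in>UNIV. \<Sum>\<alpha>\<in>UNIV. if \<alpha> = \<gamma> - {i} then (if i \<in> \<gamma> then K i else 0) else 0)"
    by (subst sum.swap) (intro sum.cong refl, auto)
  also have "\<dots> = (\<Sum>i\<in>\<gamma>. K i)"
    by (simp add: sum.delta sum.If_cases)
  also have "\<dots> = (\<Sum>i\<in>\<gamma>. shuffle_sign \<gamma> (- \<gamma>) * (- 1) ^ (card \<gamma> - 1) *
    (shuffle_sign {i} (\<gamma> - {i}) * u $ (\<gamma> - {i}) * partial_deriv i \<phi> x))"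
  proof (intro sum.cong refl)
    fix i assume i: "i \<in> \<gamma>"
    have e: "- (\<gamma> - {i}) = {i} \<union> - \<gamma>" "\<gamma> = {i} \<union> (\<gamma> - {i})"
      using i by auto
    have "shuffle_sign \<gamma> (- \<gamma>) = shuffle_sign {i} (- \<gamma>) * shuffle_sign (\<gamma> - {i}) (- \<gamma>)"
      using shuffle_sign_Un_left[of "{i}" "\<gamma> - {i}" "- \<gamma>"] e(2) by simp
    moreover have "shuffle_sign (\<gamma> - {i}) (- (\<gamma> - {i})) =
        shuffle_sign (\<gamma> - {i}) {i} * shuffle_sign (\<gamma> - {i}) (- \<gamma>)"
      unfolding e(1) using i by (intro shuffle_sign_Un_right) auto
    moreover have "shuffle_sign (\<gamma> - {i}) {i} = (- 1) ^ (card \<gamma> - 1) * shuffle_sign {i} (\<gamma> - {i})"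
      using shuffle_sign_swap[of "{i}" "\<gamma> - {i}"] i by (simp add: card_Diff_singleton)
    ultimately show "K i = shuffle_sign \<gamma> (- \<gamma>) * (- 1) ^ (card \<gamma> - 1) *
      (shuffle_sign {i} (\<gamma> - {i}) * u $ (\<gamma> - {i}) * partial_deriv i \<phi> x)"
      by (simp add: K_def mult_ac)
  qed
  finally show ?thesis
    by (simp add: sum_distrib_left)
qed

theorem theorem3p1:
  fixes lam Delta mu :: "('n::{finite,linorder}) form" and h :: nat
  assumes "h + 1 \<le> CARD('n)"
    and "continuous_form h lam"
    and "continuous_form (h + 1) Delta"
    and "\<And>\<omega> :: 'n form. Cc_infinity_form (CARD('n) - h - 1) \<omega> \<Longrightarrow>
      form_integral (\<lambda>x. wedge (Delta x) (\<omega> x)) =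
      form_integral (\<lambda>x. wedge (lam x) (ext_deriv \<omega> x))"
    and "C1_form (h + 1) mu"
  shows "\<forall>x \<in> density_points (real CARD('n) + 1) {y. Delta y = mu y}. ext_deriv mu x = 0"
proof
  fix x assume x: "x \<in> density_points (real CARD('n) + 1) {y. Delta y = mu y}"
  have "ext_deriv mu x $ \<gamma> = 0" for \<gamma>
  proof (cases "card \<gamma> = h + 2")
    case False
    then show ?thesis
      using of_degree_ext_deriv[of "h + 1" mu] assms(5) by (simp add: C1_form_def of_degree_def)
  next
    case True
    have card_compl: "card (- \<gamma>) = CARD('n) - h - 2" "h + 2 \<le> CARD('n)"
      using True card_mono[of UNIV \<gamma>] by (auto simp: Compl_eq_Diff_UNIV card_Diff_subset)
    \<comment> \<open>the divergence of \<open>field f\<close> is the \<open>\<gamma>\<close>-component of \<open>d f\<close>\<close>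
    define field where "field f i y = (if i \<in> \<gamma> then shuffle_sign {i} (\<gamma> - {i}) * f y $ (\<gamma> - {i}) else 0)"
      for f :: "'n form" and i y
    have "(\<Sum>i\<in>UNIV. partial_deriv i (field mu i) x) = 0"
    proof (rule divergence_eq_0_at_density_point)
      show "continuous_on UNIV (field Delta i)" for i
      proof -
        have "continuous_on UNIV (\<lambda>y. Delta y $ (\<gamma> - {i}))"
          using assms(3) by (simp add: continuous_form_def)
        then show ?thesis
          by (cases "i \<in> \<gamma>") (simp_all add: field_def[abs_def] continuous_on_mult_left)
      qed
      show mu1: "Ck 1 (field mu i)" for i
      proof (cases "i \<in> \<gamma>")
        case True
        have "Ck 1 (\<lambda>y. shuffle_sign {i} (\<gamma> - {i}) * mu y $ (\<gamma> - {i}))"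
          using assms(5) by (intro Ck_mult Ck_const) (simp only: C1_form_def)
        then show ?thesis
          using True by (simp only: field_def[abs_def] if_True)
      next
        case False
        then show ?thesis
          by (simp only: field_def[abs_def] if_False Ck_const)
      qed
      show "x \<in> density_points (real CARD('n) + 1) {y. \<forall>i. field Delta i y = field mu i y}"
        by (rule subsetD[OF density_points_mono x]) (auto simp: field_def)
      fix \<phi> :: "(real, 'n) vec \<Rightarrow> real" assume \<phi>: "Cc_infinity \<phi>"
      \<comment> \<open>the exact form \<open>d\<eta>\<close> tests \<open>Delta\<close> only, because \<open>d d\<eta> = 0\<close>\<close>
      define \<eta> where "\<eta> y = \<phi> y *\<^sub>R (axis (- \<gamma>) 1 :: 'n covector)" for y
      have "Cc_infinity (\<lambda>y. \<eta> y $ \<alpha>)" for \<alpha>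
        using \<phi> by (cases "\<alpha> = - \<gamma>") (simp_all add: \<eta>_def axis_def Cc_infinity_0)
      then have \<eta>: "Cc_infinity_form (CARD('n) - h - 2) \<eta>"
        using card_compl by (auto simp: Cc_infinity_form_def of_degree_def \<eta>_def axis_def)
      have "Suc (CARD('n) - h - 2) = CARD('n) - h - 1"
        using card_compl(2) by simp
      then have "Cc_infinity_form (CARD('n) - h - 1) (ext_deriv \<eta>)"
        using Cc_infinity_form_ext_deriv[OF \<eta>] by simp
      from assms(4)[OF this]
      have "form_integral (\<lambda>y. wedge (Delta y) (ext_deriv \<eta> y)) =
        form_integral (\<lambda>y. wedge (lam y) (ext_deriv (ext_deriv \<eta>) y))" .
      moreover have "ext_deriv (ext_deriv \<eta>) y = 0" for y
        using \<eta> by (intro ext_deriv_ext_deriv) (simp only: Cc_infinity_form_def Cc_infinity_def)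
      moreover have "wedge w 0 = 0" for w :: "'n covector"
        by (simp add: wedge_def vec_eq_iff)
      ultimately have "form_integral (\<lambda>y. wedge (Delta y) (ext_deriv \<eta> y)) = 0"
        by (simp add: form_integral_def)
      moreover have "wedge (Delta y) (ext_deriv \<eta> y) $ UNIV =
        shuffle_sign \<gamma> (- \<gamma>) * (- 1) ^ (card \<gamma> - 1) *
        (\<Sum>i\<in>UNIV. field Delta i y * partial_deriv i \<phi> y)" for y
        unfolding \<eta>_def[abs_def] wedge_ext_deriv_complementary_basis
        by (simp add: field_def if_distrib[of "\<lambda>z. z * _"] sum.If_cases)
      moreover have "shuffle_sign \<gamma> (- \<gamma>) \<noteq> 0"
        by (simp add: shuffle_sign_def)
      ultimately show "(LINT y|lborel. (\<Sum>i\<in>UNIV. field Delta i y * partial_deriv i \<phi> y)) = 0"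
        by (simp add: form_integral_def)
    qed
    moreover have "partial_deriv i (field mu i) x = (if i \<in> \<gamma> then
      shuffle_sign {i} (\<gamma> - {i}) * partial_deriv i (\<lambda>y. mu y $ (\<gamma> - {i})) x else 0)" for i
    proof -
      have "(\<lambda>y. mu y $ (\<gamma> - {i})) differentiable_on UNIV"
        using assms(5) by (simp add: C1_form_def)
      then show ?thesis
        by (simp add: field_def[abs_def] partial_deriv_cmult partial_deriv_const)
    qed
    ultimately show ?thesis
      by (simp add: ext_deriv_component sum.If_cases)
  qed
  then show "ext_deriv mu x = 0"
    by (simp add: vec_eq_iff)
qed

end
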